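(* Let $S$ be a multiplicatively closed subset of a commutative ring $R$ with non-zero identity and let $M$ be an $R$-module. If $N$ is a 1-absorbing primary submodule of $M$ and $S^{-1}N\neq S^{-1}M$, then $S^{-1}N$ is a 1-absorbing primary submodule of the $S^{-1}R$-module $S^{-1}M$.
   Context: All rings are commutative with non-zero identity and all modules are unitary. For a submodule $N$ of an $R$-module $M$, $(N:_R M)=\{r\in R: rM\subseteq N\}$. A proper submodule $P$ of $M$ is prime if for $a\in R$, $m\in M$, $am\in P$ implies $m\in P$ or $a\in (P:_R M)$. $M\text{-}\mathrm{rad}(N)$ is the intersection of all prime submodules of $M$ containing $N$, and $M\text{-}\mathrm{rad}(N)=M$ if there is no such prime submodule. A proper submodule $N$ of an $R$-module $M$ is a 1-absorbing primary submodule if whenever $a,b\in R$ are non-unit elements and $m\in M$ with $abm\in N$, then $ab\in (N:_R M)$ or $m\in M\text{-}\mathrm{rad}(N)$. *)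

theory Defs
  imports "HOL-Algebra.Module"
begin

section \<open>Prime submodules, the radical, and 1-absorbing primary submodules\<close>

text \<open>Argument order follows the library locale \<open>submodule H R M\<close>.\<close>

definition submodule_colon :: "'b set \<Rightarrow> ('a, 'r) ring_scheme \<Rightarrow> ('a, 'b, 'm) module_scheme \<Rightarrow> 'a set"
  where "submodule_colon N R M = {r \<in> carrier R. \<forall>m \<in> carrier M. r \<odot>\<^bsub>M\<^esub> m \<in> N}"

definition prime_submodule :: "'b set \<Rightarrow> ('a, 'r) ring_scheme \<Rightarrow> ('a, 'b, 'm) module_scheme \<Rightarrow> bool"
  where "prime_submodule P R M \<longleftrightarrow>
    submodule P R M \<and> P \<noteq> carrier M \<and>
    (\<forall>a \<in> carrier R. \<forall>m \<in> carrier M.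
       a \<odot>\<^bsub>M\<^esub> m \<in> P \<longrightarrow> m \<in> P \<or> a \<in> submodule_colon P R M)"

definition submodule_rad :: "'b set \<Rightarrow> ('a, 'r) ring_scheme \<Rightarrow> ('a, 'b, 'm) module_scheme \<Rightarrow> 'b set"
  where "submodule_rad N R M =
    (if \<exists>P. prime_submodule P R M \<and> N \<subseteq> P
     then \<Inter>{P. prime_submodule P R M \<and> N \<subseteq> P}
     else carrier M)"

definition one_absorbing_primary_submodule ::
    "'b set \<Rightarrow> ('a, 'r) ring_scheme \<Rightarrow> ('a, 'b, 'm) module_scheme \<Rightarrow> bool"
  where "one_absorbing_primary_submodule N R M \<longleftrightarrow>
    submodule N R M \<and> N \<noteq> carrier M \<and>
    (\<forall>a \<in> carrier R - Units R. \<forall>b \<in> carrier R - Units R. \<forall>m \<in> carrier M.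
       (a \<otimes>\<^bsub>R\<^esub> b) \<odot>\<^bsub>M\<^esub> m \<in> N \<longrightarrow>
       a \<otimes>\<^bsub>R\<^esub> b \<in> submodule_colon N R M \<or> m \<in> submodule_rad N R M)"


section \<open>Localization\<close>

text \<open>A multiplicatively closed subset of a ring is a submonoid of its multiplicative monoid
  (library locale \<open>submonoid S R\<close>); in particular it contains \<open>\<one>\<close>, and it may contain \<open>\<zero>\<close>.\<close>

definition frac_rel :: "('a, 'r) ring_scheme \<Rightarrow> 'a set \<Rightarrow> ('a, 'b, 'm) module_scheme
    \<Rightarrow> (('b \<times> 'a) \<times> ('b \<times> 'a)) set"
  where "frac_rel R S M =
    {((m, s), (m', s')). m \<in> carrier M \<and> s \<in> S \<and> m' \<in> carrier M \<and> s' \<in> S \<and>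
       (\<exists>u \<in> S. u \<odot>\<^bsub>M\<^esub> (s' \<odot>\<^bsub>M\<^esub> m) = u \<odot>\<^bsub>M\<^esub> (s \<odot>\<^bsub>M\<^esub> m'))}"

text \<open>The fraction \<open>m / s\<close> is an equivalence class.\<close>

definition frac :: "('a, 'r) ring_scheme \<Rightarrow> 'a set \<Rightarrow> ('a, 'b, 'm) module_scheme
    \<Rightarrow> 'b \<Rightarrow> 'a \<Rightarrow> ('b \<times> 'a) set"
  where "frac R S M m s = frac_rel R S M `` {(m, s)}"

definition regular_module :: "('a, 'r) ring_scheme \<Rightarrow> ('a, 'a) module"
  where "regular_module R =
    \<lparr>carrier = carrier R, mult = mult R, one = one R, zero = zero R, add = add R, smult = mult R\<rparr>"

text \<open>The operations are the usual quotient-set unions over representatives. They are evaluated on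
  fractions below. Elements of \<open>S\<inverse>R\<close> are fractions of the regular module. The ring fields
  \<open>mult\<close> and \<open>one\<close> of a module record play no role.\<close>

definition loc_ring :: "('a, 'r) ring_scheme \<Rightarrow> 'a set \<Rightarrow> ('a \<times> 'a) set ring"
  where "loc_ring R S =
    \<lparr>carrier = (carrier R \<times> S) // frac_rel R S (regular_module R),
     mult = (\<lambda>X Y. \<Union>(a, s) \<in> X. \<Union>(b, t) \<in> Y.
               frac R S (regular_module R) (a \<otimes>\<^bsub>R\<^esub> b) (s \<otimes>\<^bsub>R\<^esub> t)),
     one = frac R S (regular_module R) \<one>\<^bsub>R\<^esub> \<one>\<^bsub>R\<^esub>,
     zero = frac R S (regular_module R) \<zero>\<^bsub>R\<^esub> \<one>\<^bsub>R\<^esub>,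
     add = (\<lambda>X Y. \<Union>(a, s) \<in> X. \<Union>(b, t) \<in> Y.
              frac R S (regular_module R) (t \<otimes>\<^bsub>R\<^esub> a \<oplus>\<^bsub>R\<^esub> s \<otimes>\<^bsub>R\<^esub> b) (s \<otimes>\<^bsub>R\<^esub> t))\<rparr>"

definition loc_module :: "('a, 'r) ring_scheme \<Rightarrow> 'a set \<Rightarrow> ('a, 'b, 'm) module_scheme
    \<Rightarrow> (('a \<times> 'a) set, ('b \<times> 'a) set) module"
  where "loc_module R S M =
    \<lparr>carrier = (carrier M \<times> S) // frac_rel R S M,
     mult = undefined,
     one = undefined,
     zero = frac R S M \<zero>\<^bsub>M\<^esub> \<one>\<^bsub>R\<^esub>,
     add = (\<lambda>X Y. \<Union>(m, s) \<in> X. \<Union>(n, t) \<in> Y.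
              frac R S M (t \<odot>\<^bsub>M\<^esub> m \<oplus>\<^bsub>M\<^esub> s \<odot>\<^bsub>M\<^esub> n) (s \<otimes>\<^bsub>R\<^esub> t)),
     smult = (\<lambda>X Y. \<Union>(a, s) \<in> X. \<Union>(m, t) \<in> Y. frac R S M (a \<odot>\<^bsub>M\<^esub> m) (s \<otimes>\<^bsub>R\<^esub> t))\<rparr>"

text \<open>\<open>S\<inverse>N\<close> as a subset of \<open>S\<inverse>M\<close>: fractions are formed in \<open>M\<close>, so a fraction in \<open>S\<inverse>N\<close> may
  also have representatives whose numerator is not in \<open>N\<close>.\<close>

definition loc_submodule :: "('a, 'r) ring_scheme \<Rightarrow> 'a set \<Rightarrow> ('a, 'b, 'm) module_scheme
    \<Rightarrow> 'b set \<Rightarrow> ('b \<times> 'a) set set"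
  where "loc_submodule R S M N = {frac R S M n s | n s. n \<in> N \<and> s \<in> S}"


section \<open>The localization is a module over the localized ring\<close>

locale module_localization = module R M + S: submonoid S R
  for R (structure) and M (structure) and S
begin

abbreviation fr where "fr \<equiv> frac R S M"

lemma smult_left_commute:
  "\<lbrakk>a \<in> carrier R; b \<in> carrier R; x \<in> carrier M\<rbrakk> \<Longrightarrow> a \<odot>\<^bsub>M\<^esub> (b \<odot>\<^bsub>M\<^esub> x) = b \<odot>\<^bsub>M\<^esub> (a \<odot>\<^bsub>M\<^esub> x)"
  by (metis smult_assoc1 R.m_comm)

lemmas smult_ac = smult_assoc1 smult_left_commute smult_r_distr

lemma equiv_frac_rel: "equiv (carrier M \<times> S) (frac_rel R S M)"
proof (rule equivI)
  show "refl_on (carrier M \<times> S) (frac_rel R S M)"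
    using S.one_closed by (force simp: refl_on_def frac_rel_def)
  show "frac_rel R S M \<subseteq> (carrier M \<times> S) \<times> (carrier M \<times> S)"
    by (auto simp: frac_rel_def)
  show "sym (frac_rel R S M)"
    unfolding sym_def frac_rel_def by (auto intro: sym)
  show "trans (frac_rel R S M)"
  proof (rule transI, clarify)
    fix m s m' s' m'' s''
    assume "((m, s), m', s') \<in> frac_rel R S M" "((m', s'), m'', s'') \<in> frac_rel R S M"
    then obtain u v where c: "m \<in> carrier M" "m' \<in> carrier M" "m'' \<in> carrier M"
        "s \<in> S" "s' \<in> S" "s'' \<in> S" "u \<in> S" "v \<in> S"
      and u: "u \<odot>\<^bsub>M\<^esub> (s' \<odot>\<^bsub>M\<^esub> m) = u \<odot>\<^bsub>M\<^esub> (s \<odot>\<^bsub>M\<^esub> m')"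
      and v: "v \<odot>\<^bsub>M\<^esub> (s'' \<odot>\<^bsub>M\<^esub> m') = v \<odot>\<^bsub>M\<^esub> (s' \<odot>\<^bsub>M\<^esub> m'')"
      by (auto simp: frac_rel_def)
    let ?w = "u \<otimes> v \<otimes> s'"
    have "?w \<odot>\<^bsub>M\<^esub> (s'' \<odot>\<^bsub>M\<^esub> m) = v \<odot>\<^bsub>M\<^esub> (s'' \<odot>\<^bsub>M\<^esub> (u \<odot>\<^bsub>M\<^esub> (s' \<odot>\<^bsub>M\<^esub> m)))"
      using c by (simp add: smult_ac)
    also have "\<dots> = u \<odot>\<^bsub>M\<^esub> (s \<odot>\<^bsub>M\<^esub> (v \<odot>\<^bsub>M\<^esub> (s'' \<odot>\<^bsub>M\<^esub> m')))"
      unfolding u using c by (simp add: smult_ac)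
    also have "\<dots> = ?w \<odot>\<^bsub>M\<^esub> (s \<odot>\<^bsub>M\<^esub> m'')"
      unfolding v using c by (simp add: smult_ac)
    finally show "((m, s), m'', s'') \<in> frac_rel R S M"
      using c by (auto simp: frac_rel_def intro!: bexI[of _ ?w])
  qed
qed

lemma frac_eq_iff:
  assumes "m \<in> carrier M" "s \<in> S" "m' \<in> carrier M" "s' \<in> S"
  shows "fr m s = fr m' s' \<longleftrightarrow>
    (\<exists>u \<in> S. u \<odot>\<^bsub>M\<^esub> (s' \<odot>\<^bsub>M\<^esub> m) = u \<odot>\<^bsub>M\<^esub> (s \<odot>\<^bsub>M\<^esub> m'))"
  using eq_equiv_class_iff[OF equiv_frac_rel, of "(m, s)" "(m', s')"] assms
  by (auto simp: frac_def frac_rel_def)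

lemma frac_eqI:
  assumes "m \<in> carrier M" "s \<in> S" "m' \<in> carrier M" "s' \<in> S"
    and "s' \<odot>\<^bsub>M\<^esub> m = s \<odot>\<^bsub>M\<^esub> m'"
  shows "fr m s = fr m' s'"
  using assms by (auto simp: frac_eq_iff)

lemma carrier_loc: "carrier (loc_module R S M) = {fr m s | m s. m \<in> carrier M \<and> s \<in> S}"
  by (auto simp: loc_module_def quotient_def frac_def)

lemma frac_closed [simp]:
  "\<lbrakk>m \<in> carrier M; s \<in> S\<rbrakk> \<Longrightarrow> fr m s \<in> carrier (loc_module R S M)"
  by (auto simp: carrier_loc)

lemma zero_loc: "\<zero>\<^bsub>loc_module R S M\<^esub> = fr \<zero>\<^bsub>M\<^esub> \<one>"
  by (simp add: loc_module_def)

lemma add_frac: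
  assumes "m \<in> carrier M" "s \<in> S" "n \<in> carrier M" "t \<in> S"
  shows "fr m s \<oplus>\<^bsub>loc_module R S M\<^esub> fr n t
    = fr (t \<odot>\<^bsub>M\<^esub> m \<oplus>\<^bsub>M\<^esub> s \<odot>\<^bsub>M\<^esub> n) (s \<otimes> t)"
proof -
  let ?f = "\<lambda>(m, s). \<lambda>(n, t). fr (t \<odot>\<^bsub>M\<^esub> m \<oplus>\<^bsub>M\<^esub> s \<odot>\<^bsub>M\<^esub> n) (s \<otimes> t)"
  have "congruent2 (frac_rel R S M) (frac_rel R S M) ?f"
  proof (rule congruent2I', clarify)
    fix m s m' s' n t n' t'
    assume "((m, s), m', s') \<in> frac_rel R S M" "((n, t), n', t') \<in> frac_rel R S M"
    then obtain u v where c: "m \<in> carrier M" "m' \<in> carrier M" "n \<in> carrier M" "n' \<in> carrier M"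
        "s \<in> S" "s' \<in> S" "t \<in> S" "t' \<in> S" "u \<in> S" "v \<in> S"
      and u: "u \<odot>\<^bsub>M\<^esub> (s' \<odot>\<^bsub>M\<^esub> m) = u \<odot>\<^bsub>M\<^esub> (s \<odot>\<^bsub>M\<^esub> m')"
      and v: "v \<odot>\<^bsub>M\<^esub> (t' \<odot>\<^bsub>M\<^esub> n) = v \<odot>\<^bsub>M\<^esub> (t \<odot>\<^bsub>M\<^esub> n')"
      by (auto simp: frac_rel_def)
    have "(u \<otimes> v) \<odot>\<^bsub>M\<^esub> ((s' \<otimes> t') \<odot>\<^bsub>M\<^esub> (t \<odot>\<^bsub>M\<^esub> m \<oplus>\<^bsub>M\<^esub> s \<odot>\<^bsub>M\<^esub> n))
      = v \<odot>\<^bsub>M\<^esub> (t \<odot>\<^bsub>M\<^esub> (t' \<odot>\<^bsub>M\<^esub> (u \<odot>\<^bsub>M\<^esub> (s' \<odot>\<^bsub>M\<^esub> m))))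
        \<oplus>\<^bsub>M\<^esub> u \<odot>\<^bsub>M\<^esub> (s \<odot>\<^bsub>M\<^esub> (s' \<odot>\<^bsub>M\<^esub> (v \<odot>\<^bsub>M\<^esub> (t' \<odot>\<^bsub>M\<^esub> n))))"
      using c by (simp add: smult_ac)
    also have "\<dots> = (u \<otimes> v) \<odot>\<^bsub>M\<^esub> ((s \<otimes> t) \<odot>\<^bsub>M\<^esub> (t' \<odot>\<^bsub>M\<^esub> m' \<oplus>\<^bsub>M\<^esub> s' \<odot>\<^bsub>M\<^esub> n'))"
      unfolding u v using c by (simp add: smult_ac)
    finally show "fr (t \<odot>\<^bsub>M\<^esub> m \<oplus>\<^bsub>M\<^esub> s \<odot>\<^bsub>M\<^esub> n) (s \<otimes> t)
        = fr (t' \<odot>\<^bsub>M\<^esub> m' \<oplus>\<^bsub>M\<^esub> s' \<odot>\<^bsub>M\<^esub> n') (s' \<otimes> t')"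
      using c by (subst frac_eq_iff) (auto intro!: bexI[of _ "u \<otimes> v"])
  qed
  from UN_equiv_class2[OF equiv_frac_rel equiv_frac_rel this, of "(m, s)" "(n, t)"] assms
  show ?thesis
    by (simp add: loc_module_def frac_def case_prod_beta')
qed

lemma loc_cases:
  assumes "x \<in> carrier (loc_module R S M)"
  obtains m s where "m \<in> carrier M" "s \<in> S" "x = fr m s"
  using assms by (auto simp: carrier_loc)

lemma abelian_group_loc: "abelian_group (loc_module R S M)"
proof (rule abelian_groupI)
  show "\<zero>\<^bsub>loc_module R S M\<^esub> \<in> carrier (loc_module R S M)"
    by (simp add: zero_loc)
next
  fix x y assume "x \<in> carrier (loc_module R S M)" "y \<in> carrier (loc_module R S M)"
  then show "x \<oplus>\<^bsub>loc_module R S M\<^esub> y \<in> carrier (loc_module R S M)"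
    by (elim loc_cases) (simp add: add_frac)
next
  fix x y assume "x \<in> carrier (loc_module R S M)" "y \<in> carrier (loc_module R S M)"
  then show "x \<oplus>\<^bsub>loc_module R S M\<^esub> y = y \<oplus>\<^bsub>loc_module R S M\<^esub> x"
    by (elim loc_cases) (simp add: add_frac M.a_comm R.m_comm)
next
  fix x y z
  assume "x \<in> carrier (loc_module R S M)" "y \<in> carrier (loc_module R S M)"
    "z \<in> carrier (loc_module R S M)"
  then show "x \<oplus>\<^bsub>loc_module R S M\<^esub> y \<oplus>\<^bsub>loc_module R S M\<^esub> z
      = x \<oplus>\<^bsub>loc_module R S M\<^esub> (y \<oplus>\<^bsub>loc_module R S M\<^esub> z)"
    by (elim loc_cases) (simp add: add_frac M.a_assoc R.m_assoc smult_ac)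
next
  fix x assume "x \<in> carrier (loc_module R S M)"
  then show "\<zero>\<^bsub>loc_module R S M\<^esub> \<oplus>\<^bsub>loc_module R S M\<^esub> x = x"
    by (elim loc_cases) (simp add: zero_loc add_frac)
next
  fix x assume "x \<in> carrier (loc_module R S M)"
  then obtain m s where x: "m \<in> carrier M" "s \<in> S" "x = fr m s"
    by (elim loc_cases)
  then have "fr (\<ominus>\<^bsub>M\<^esub> m) s \<oplus>\<^bsub>loc_module R S M\<^esub> x = fr \<zero>\<^bsub>M\<^esub> \<one>"
    by (simp add: add_frac smult_r_minus M.l_neg) (rule frac_eqI, simp_all)
  with x show "\<exists>y \<in> carrier (loc_module R S M). y \<oplus>\<^bsub>loc_module R S M\<^esub> x = \<zero>\<^bsub>loc_module R S M\<^esub>"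
    by (auto simp: zero_loc intro!: bexI[of _ "fr (\<ominus>\<^bsub>M\<^esub> m) s"])
qed

end

lemma regular_module_sel [simp]:
  "carrier (regular_module R) = carrier R" "zero (regular_module R) = zero R"
  "add (regular_module R) = add R" "smult (regular_module R) = mult R"
  by (simp_all add: regular_module_def)

lemma loc_ring_sel:
  "carrier (loc_ring R S) = carrier (loc_module R S (regular_module R))"
  "zero (loc_ring R S) = zero (loc_module R S (regular_module R))"
  "add (loc_ring R S) = add (loc_module R S (regular_module R))"
  "mult (loc_ring R S) = smult (loc_module R S (regular_module R))"
  "one (loc_ring R S) = frac R S (regular_module R) \<one>\<^bsub>R\<^esub> \<one>\<^bsub>R\<^esub>"
  by (simp_all add: loc_ring_def loc_module_def)

lemma (in cring) module_regular_module: "module R (regular_module R)"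
proof (rule moduleI)
  show "abelian_group (regular_module R)"
    by (rule abelian_groupI)
      (auto simp: add.m_ac intro: bexI[of _ "\<ominus> x" for x] l_neg)
qed (auto simp: l_distr r_distr m_assoc intro: is_cring)

context module_localization
begin

sublocale reg: module_localization R "regular_module R" S
  by (intro module_localization.intro module_regular_module S.submonoid_axioms)

lemma smult_frac:
  assumes "a \<in> carrier R" "s \<in> S" "m \<in> carrier M" "t \<in> S"
  shows "reg.fr a s \<odot>\<^bsub>loc_module R S M\<^esub> fr m t = fr (a \<odot>\<^bsub>M\<^esub> m) (s \<otimes> t)"
proof -
  let ?f = "\<lambda>(a, s). \<lambda>(m, t). fr (a \<odot>\<^bsub>M\<^esub> m) (s \<otimes> t)"
  have "congruent2 (frac_rel R S (regular_module R)) (frac_rel R S M) ?f"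
  proof (rule congruent2I', clarify)
    fix a s a' s' m t m' t'
    assume "((a, s), a', s') \<in> frac_rel R S (regular_module R)"
      "((m, t), m', t') \<in> frac_rel R S M"
    then obtain u v where c: "a \<in> carrier R" "a' \<in> carrier R" "m \<in> carrier M" "m' \<in> carrier M"
        "s \<in> S" "s' \<in> S" "t \<in> S" "t' \<in> S" "u \<in> S" "v \<in> S"
      and u: "u \<otimes> (s' \<otimes> a) = u \<otimes> (s \<otimes> a')"
      and v: "v \<odot>\<^bsub>M\<^esub> (t' \<odot>\<^bsub>M\<^esub> m) = v \<odot>\<^bsub>M\<^esub> (t \<odot>\<^bsub>M\<^esub> m')"
      by (auto simp: frac_rel_def)
    have "(u \<otimes> v) \<odot>\<^bsub>M\<^esub> ((s' \<otimes> t') \<odot>\<^bsub>M\<^esub> (a \<odot>\<^bsub>M\<^esub> m))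
      = (u \<otimes> (s' \<otimes> a)) \<odot>\<^bsub>M\<^esub> (v \<odot>\<^bsub>M\<^esub> (t' \<odot>\<^bsub>M\<^esub> m))"
      using c by (simp add: smult_ac)
    also have "\<dots> = (u \<otimes> v) \<odot>\<^bsub>M\<^esub> ((s \<otimes> t) \<odot>\<^bsub>M\<^esub> (a' \<odot>\<^bsub>M\<^esub> m'))"
      unfolding u v using c by (simp add: smult_ac)
    finally show "fr (a \<odot>\<^bsub>M\<^esub> m) (s \<otimes> t) = fr (a' \<odot>\<^bsub>M\<^esub> m') (s' \<otimes> t')"
      using c by (subst frac_eq_iff) (auto intro!: bexI[of _ "u \<otimes> v"])
  qed
  from UN_equiv_class2[OF reg.equiv_frac_rel equiv_frac_rel this, of "(a, s)" "(m, t)"] assms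
  show ?thesis
    by (simp add: loc_module_def frac_def case_prod_beta')
qed

end

context module_localization
begin

lemma cring_loc_ring: "cring (loc_ring R S)"
proof (rule cringI)
  show "abelian_group (loc_ring R S)"
  proof -
    interpret L: abelian_group "loc_module R S (regular_module R)"
      by (rule reg.abelian_group_loc)
    show ?thesis
      by (rule abelian_groupI; unfold loc_ring_sel)
        (auto simp: L.a_ac intro: L.l_neg L.a_inv_closed)
  qed
  show "Group.comm_monoid (loc_ring R S)"
  proof (rule comm_monoidI; unfold loc_ring_sel)
    fix x y z
    assume "x \<in> carrier (loc_module R S (regular_module R))"
      "y \<in> carrier (loc_module R S (regular_module R))"
      "z \<in> carrier (loc_module R S (regular_module R))"
    then show "x \<odot>\<^bsub>loc_module R S (regular_module R)\<^esub> y \<odot>\<^bsub>loc_module R S (regular_module R)\<^esub> z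
      = x \<odot>\<^bsub>loc_module R S (regular_module R)\<^esub> (y \<odot>\<^bsub>loc_module R S (regular_module R)\<^esub> z)"
      by (elim reg.loc_cases) (simp add: reg.smult_frac R.m_assoc)
  qed (auto elim!: reg.loc_cases simp: reg.smult_frac R.m_comm)
  fix x y z
  assume "x \<in> carrier (loc_ring R S)" "y \<in> carrier (loc_ring R S)" "z \<in> carrier (loc_ring R S)"
  then obtain a s b t c r where abc: "a \<in> carrier R" "s \<in> S" "b \<in> carrier R" "t \<in> S"
      "c \<in> carrier R" "r \<in> S" "x = reg.fr a s" "y = reg.fr b t" "z = reg.fr c r"
    unfolding loc_ring_sel by (elim reg.loc_cases) auto
  then show "(x \<oplus>\<^bsub>loc_ring R S\<^esub> y) \<otimes>\<^bsub>loc_ring R S\<^esub> z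
      = x \<otimes>\<^bsub>loc_ring R S\<^esub> z \<oplus>\<^bsub>loc_ring R S\<^esub> y \<otimes>\<^bsub>loc_ring R S\<^esub> z"
    unfolding loc_ring_sel
    by (simp add: reg.smult_frac reg.add_frac)
      (rule reg.frac_eqI, simp_all add: R.l_distr R.r_distr R.m_ac)
qed

theorem module_loc_module: "module (loc_ring R S) (loc_module R S M)"
proof (rule moduleI[OF cring_loc_ring abelian_group_loc]; unfold loc_ring_sel)
  fix a x
  assume "a \<in> carrier (loc_module R S (regular_module R))" "x \<in> carrier (loc_module R S M)"
  then show "a \<odot>\<^bsub>loc_module R S M\<^esub> x \<in> carrier (loc_module R S M)"
    by (elim reg.loc_cases loc_cases) (simp add: smult_frac)
next
  fix a b x
  assume "a \<in> carrier (loc_module R S (regular_module R))"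
    "b \<in> carrier (loc_module R S (regular_module R))" "x \<in> carrier (loc_module R S M)"
  then obtain a' s b' t m r where "a' \<in> carrier R" "s \<in> S" "b' \<in> carrier R" "t \<in> S"
      "m \<in> carrier M" "r \<in> S" "a = reg.fr a' s" "b = reg.fr b' t" "x = fr m r"
    by (elim reg.loc_cases loc_cases) auto
  then show "(a \<oplus>\<^bsub>loc_module R S (regular_module R)\<^esub> b) \<odot>\<^bsub>loc_module R S M\<^esub> x
      = a \<odot>\<^bsub>loc_module R S M\<^esub> x \<oplus>\<^bsub>loc_module R S M\<^esub> b \<odot>\<^bsub>loc_module R S M\<^esub> x"
    by (simp add: smult_frac reg.add_frac add_frac)
      (rule frac_eqI, simp_all add: smult_ac smult_l_distr)
next
  fix a x y
  assume "a \<in> carrier (loc_module R S (regular_module R))"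
    "x \<in> carrier (loc_module R S M)" "y \<in> carrier (loc_module R S M)"
  then obtain a' s m t n r where "a' \<in> carrier R" "s \<in> S" "m \<in> carrier M" "t \<in> S"
      "n \<in> carrier M" "r \<in> S" "a = reg.fr a' s" "x = fr m t" "y = fr n r"
    by (elim reg.loc_cases loc_cases) auto
  then show "a \<odot>\<^bsub>loc_module R S M\<^esub> (x \<oplus>\<^bsub>loc_module R S M\<^esub> y)
      = a \<odot>\<^bsub>loc_module R S M\<^esub> x \<oplus>\<^bsub>loc_module R S M\<^esub> a \<odot>\<^bsub>loc_module R S M\<^esub> y"
    by (simp add: smult_frac add_frac) (rule frac_eqI, simp_all add: smult_ac)
next
  fix a b x
  assume "a \<in> carrier (loc_module R S (regular_module R))"
    "b \<in> carrier (loc_module R S (regular_module R))" "x \<in> carrier (loc_module R S M)"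
  then obtain a' s b' t m r where "a' \<in> carrier R" "s \<in> S" "b' \<in> carrier R" "t \<in> S"
      "m \<in> carrier M" "r \<in> S" "a = reg.fr a' s" "b = reg.fr b' t" "x = fr m r"
    by (elim reg.loc_cases loc_cases) auto
  then show "(a \<odot>\<^bsub>loc_module R S (regular_module R)\<^esub> b) \<odot>\<^bsub>loc_module R S M\<^esub> x
      = a \<odot>\<^bsub>loc_module R S M\<^esub> (b \<odot>\<^bsub>loc_module R S M\<^esub> x)"
    by (simp add: smult_frac reg.smult_frac smult_assoc1 R.m_assoc)
next
  fix x assume "x \<in> carrier (loc_module R S M)"
  then show "reg.fr \<one> \<one> \<odot>\<^bsub>loc_module R S M\<^esub> x = x"
    by (elim loc_cases) (simp add: smult_frac)
qed

end

end

theory Submission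
  imports Defs
begin

text \<open>
  A relation \<open>(a/s)(b/t)(m/r) \<in> S\<inverse>N\<close> says no more than \<open>a b (u m) \<in> N\<close> for some \<open>u \<in> S\<close>
  (\<open>frac_mem_loc_submodule_iff\<close>). Units of \<open>R\<close> stay units in \<open>S\<inverse>R\<close>, so \<open>a\<close> and \<open>b\<close> are
  non-units as soon as \<open>a/s\<close> and \<open>b/t\<close> are, and the hypothesis on \<open>N\<close> applies to \<open>a\<close>, \<open>b\<close> and
  \<open>u m\<close>. Either \<open>a b M \<subseteq> N\<close>, and then \<open>(a/s)(b/t)\<close> sends \<open>S\<inverse>M\<close> into \<open>S\<inverse>N\<close>; or \<open>u m\<close>
  lies in the radical of \<open>N\<close>. In the second case \<open>m/r\<close> lies in the radical of \<open>S\<inverse>N\<close>: the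
  preimage under \<open>m \<mapsto> m/1\<close> of a prime submodule \<open>Q \<supseteq> S\<inverse>N\<close> is a prime submodule of \<open>M\<close>
  containing \<open>N\<close> (\<open>prime_submodule_contract\<close>), hence \<open>u m / 1 \<in> Q\<close>, and denominators from
  \<open>S\<close> can be changed freely inside a submodule of \<open>S\<inverse>M\<close>. If no such \<open>Q\<close> exists, the radical of
  \<open>S\<inverse>N\<close> is everything.
\<close>

section \<open>Membership in the radical\<close>

text \<open>This form of membership absorbs the convention for the case without primes.\<close>

lemma (in module) submodule_rad_iff:
  "x \<in> submodule_rad N R M \<longleftrightarrow>
    x \<in> carrier M \<and> (\<forall>P. prime_submodule P R M \<and> N \<subseteq> P \<longrightarrow> x \<in> P)"
proof -
  have "P \<subseteq> carrier M" if "prime_submodule P R M" for P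
    using that submoduleE(1) by (auto simp: prime_submodule_def)
  then show ?thesis
    by (auto simp: submodule_rad_def)
qed

section \<open>Fractions and localized submodules\<close>

context module_localization
begin

interpretation L: module "loc_ring R S" "loc_module R S M"
  by (rule module_loc_module)

lemma frac_mem_loc_ring [simp]:
  "\<lbrakk>a \<in> carrier R; s \<in> S\<rbrakk> \<Longrightarrow> reg.fr a s \<in> carrier (loc_ring R S)"
  by (simp add: loc_ring_sel)

lemma loc_ring_cases:
  assumes "x \<in> carrier (loc_ring R S)"
  obtains a s where "a \<in> carrier R" "s \<in> S" "x = reg.fr a s"
  using assms reg.loc_cases[of x thesis] by (auto simp: loc_ring_sel)

lemma mult_frac:
  assumes "a \<in> carrier R" "s \<in> S" "b \<in> carrier R" "t \<in> S"
  shows "reg.fr a s \<otimes>\<^bsub>loc_ring R S\<^esub> reg.fr b t = reg.fr (a \<otimes> b) (s \<otimes> t)"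
  using assms by (simp add: loc_ring_sel reg.smult_frac)

lemma frac_Units:
  assumes "a \<in> Units R" "s \<in> S"
  shows "reg.fr a s \<in> Units (loc_ring R S)"
proof -
  obtain b where b: "a \<in> carrier R" "b \<in> carrier R" "a \<otimes> b = \<one>"
    using assms(1) by (auto simp: Units_def)
  have "reg.fr (a \<otimes> (s \<otimes> b)) s = reg.fr \<one> \<one>"
  proof (rule reg.frac_eqI)
    have "a \<otimes> (s \<otimes> b) = s \<otimes> (a \<otimes> b)"
      using b(1,2) assms(2) by (simp add: R.m_ac)
    then show "\<one> \<odot>\<^bsub>regular_module R\<^esub> (a \<otimes> (s \<otimes> b)) = s \<odot>\<^bsub>regular_module R\<^esub> \<one>"
      using b assms(2) by simp
  qed (use b assms(2) in auto)
  then have "reg.fr a s \<otimes>\<^bsub>loc_ring R S\<^esub> reg.fr (s \<otimes> b) \<one> = \<one>\<^bsub>loc_ring R S\<^esub>"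
    using b assms(2) by (simp add: mult_frac loc_ring_sel(5))
  moreover have "reg.fr a s \<in> carrier (loc_ring R S)" "reg.fr (s \<otimes> b) \<one> \<in> carrier (loc_ring R S)"
    using b assms(2) by auto
  ultimately show ?thesis
    using L.R.m_comm[of "reg.fr a s" "reg.fr (s \<otimes> b) \<one>"] unfolding Units_def by force
qed

text \<open>Only the existence of some representative with numerator in \<open>N\<close> is built into
  \<open>S\<inverse>N\<close>; for an arbitrary representative, a factor from \<open>S\<close> has to move the numerator into
  \<open>N\<close>.\<close>

lemma frac_mem_loc_submodule_iff:
  assumes N: "submodule N R M" and m: "m \<in> carrier M" "s \<in> S"
  shows "fr m s \<in> loc_submodule R S M N \<longleftrightarrow> (\<exists>u \<in> S. u \<odot>\<^bsub>M\<^esub> m \<in> N)"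
proof
  assume "fr m s \<in> loc_submodule R S M N"
  then obtain n t where n: "n \<in> N" "t \<in> S" "fr m s = fr n t"
    by (auto simp: loc_submodule_def)
  have "n \<in> carrier M"
    using n(1) submoduleE(1)[OF N] by auto
  then obtain u where u: "u \<in> S" "u \<odot>\<^bsub>M\<^esub> (t \<odot>\<^bsub>M\<^esub> m) = u \<odot>\<^bsub>M\<^esub> (s \<odot>\<^bsub>M\<^esub> n)"
    using n m by (auto simp: frac_eq_iff)
  have "(u \<otimes> t) \<odot>\<^bsub>M\<^esub> m = u \<odot>\<^bsub>M\<^esub> (s \<odot>\<^bsub>M\<^esub> n)"
    using u n(2) m by (simp add: smult_assoc1)
  also have "\<dots> \<in> N"
    using u(1) n(1) m(2) by (intro submoduleE(4)[OF N]) auto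
  finally show "\<exists>u \<in> S. u \<odot>\<^bsub>M\<^esub> m \<in> N"
    using u(1) n(2) by blast
next
  assume "\<exists>u \<in> S. u \<odot>\<^bsub>M\<^esub> m \<in> N"
  then obtain u where u: "u \<in> S" "u \<odot>\<^bsub>M\<^esub> m \<in> N"
    by blast
  have "fr m s = fr (u \<odot>\<^bsub>M\<^esub> m) (u \<otimes> s)"
    by (rule frac_eqI) (use m u(1) in \<open>auto simp: smult_ac\<close>)
  then show "fr m s \<in> loc_submodule R S M N"
    using u m(2) by (auto simp: loc_submodule_def)
qed

lemma frac_mem_loc_submodule:
  "\<lbrakk>n \<in> N; s \<in> S\<rbrakk> \<Longrightarrow> fr n s \<in> loc_submodule R S M N"
  by (auto simp: loc_submodule_def)

lemma loc_submodule_submodule: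
  assumes N: "submodule N R M"
  shows "submodule (loc_submodule R S M N) (loc_ring R S) (loc_module R S M)"
proof -
  note NE = submoduleE[OF N]
  have sub: "loc_submodule R S M N \<subseteq> carrier (loc_module R S M)"
    using NE(1) by (auto simp: loc_submodule_def)
  have smult: "a \<odot>\<^bsub>loc_module R S M\<^esub> x \<in> loc_submodule R S M N"
    if "a \<in> carrier (loc_ring R S)" "x \<in> loc_submodule R S M N" for a x
  proof -
    obtain a' s where "a' \<in> carrier R" "s \<in> S" "a = reg.fr a' s"
      using \<open>a \<in> carrier (loc_ring R S)\<close> by (rule loc_ring_cases)
    moreover obtain n t where *: "n \<in> N" "t \<in> S" "x = fr n t"
      using \<open>x \<in> loc_submodule R S M N\<close> by (auto simp: loc_submodule_def)
    moreover have "n \<in> carrier M"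
      using * NE(1) by auto
    ultimately show ?thesis
      by (auto simp: smult_frac intro!: frac_mem_loc_submodule NE(4))
  qed
  show ?thesis
  proof (rule L.submoduleI[OF sub _ _ _ smult])
    have "\<zero>\<^bsub>M\<^esub> \<in> N"
      using subgroup.one_closed[OF submodule.axioms(1)[OF N]] by simp
    then show "\<zero>\<^bsub>loc_module R S M\<^esub> \<in> loc_submodule R S M N"
      by (simp add: zero_loc frac_mem_loc_submodule)
  next
    fix x assume x: "x \<in> loc_submodule R S M N"
    have "\<ominus>\<^bsub>loc_module R S M\<^esub> x
        = (\<ominus>\<^bsub>loc_ring R S\<^esub> \<one>\<^bsub>loc_ring R S\<^esub>) \<odot>\<^bsub>loc_module R S M\<^esub> x"
      using x sub L.smult_l_minus[of "\<one>\<^bsub>loc_ring R S\<^esub>" x] by (simp add: subset_iff)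
    then show "\<ominus>\<^bsub>loc_module R S M\<^esub> x \<in> loc_submodule R S M N"
      using smult x by simp
  next
    fix x y assume "x \<in> loc_submodule R S M N" "y \<in> loc_submodule R S M N"
    then obtain m s n t where *: "m \<in> N" "s \<in> S" "x = fr m s" "n \<in> N" "t \<in> S" "y = fr n t"
      by (auto simp: loc_submodule_def)
    moreover have "m \<in> carrier M" "n \<in> carrier M"
      using * NE(1) by auto
    ultimately show "x \<oplus>\<^bsub>loc_module R S M\<^esub> y \<in> loc_submodule R S M N"
      by (auto simp: add_frac intro!: frac_mem_loc_submodule NE(4,5))
  qed
qed

section \<open>Contraction of prime submodules and the radical\<close>

text \<open>Since \<open>1/s\<close> and \<open>u\<close> act invertibly on \<open>S\<inverse>M\<close>, a submodule cannot distinguish fractions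
  whose numerators agree up to a factor from \<open>S\<close>.\<close>

lemma frac_mem_if_smult_frac_mem:
  assumes Q: "submodule Q (loc_ring R S) (loc_module R S M)"
    and m: "m \<in> carrier M" "u \<in> S" "t \<in> S" "s \<in> S"
    and mem: "fr (u \<odot>\<^bsub>M\<^esub> m) t \<in> Q"
  shows "fr m s \<in> Q"
proof -
  have "fr m s = fr (t \<odot>\<^bsub>M\<^esub> (u \<odot>\<^bsub>M\<^esub> m)) (u \<otimes> s \<otimes> t)"
    by (rule frac_eqI) (use m in \<open>auto simp: smult_ac R.m_ac\<close>)
  also have "\<dots> = reg.fr t (u \<otimes> s) \<odot>\<^bsub>loc_module R S M\<^esub> fr (u \<odot>\<^bsub>M\<^esub> m) t"
    using m by (simp add: smult_frac)
  also have "\<dots> \<in> Q"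
    using m by (intro L.submoduleE(4)[OF Q _ mem]) auto
  finally show ?thesis .
qed

lemma frac_mem_change_denom:
  assumes "submodule Q (loc_ring R S) (loc_module R S M)"
    and "m \<in> carrier M" "t \<in> S" "s \<in> S" "fr m t \<in> Q"
  shows "fr m s \<in> Q"
  using frac_mem_if_smult_frac_mem[of Q m \<one> t s] assms by simp

text \<open>Primeness carries over because \<open>a m / 1 = (a/1)(m/1)\<close>. Properness is where the
  denominators enter: if \<open>Q\<close> contained every \<open>m/1\<close>, it would contain every \<open>m/s\<close>.\<close>

lemma prime_submodule_contract:
  assumes Q: "prime_submodule Q (loc_ring R S) (loc_module R S M)"
  shows "prime_submodule {m \<in> carrier M. fr m \<one> \<in> Q} R M" (is "prime_submodule ?P R M")
proof -
  have sQ: "submodule Q (loc_ring R S) (loc_module R S M)"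
    and neq: "Q \<noteq> carrier (loc_module R S M)"
    using Q by (auto simp: prime_submodule_def)
  note QE = L.submoduleE[OF sQ]
  have scalar: "fr (a \<odot>\<^bsub>M\<^esub> m) \<one> = reg.fr a \<one> \<odot>\<^bsub>loc_module R S M\<^esub> fr m \<one>"
    if "a \<in> carrier R" "m \<in> carrier M" for a m
    using that by (simp add: smult_frac)
  have smult: "a \<odot>\<^bsub>M\<^esub> m \<in> ?P" if "a \<in> carrier R" "m \<in> ?P" for a m
    using that by (auto simp: scalar intro: QE(4))
  have "submodule ?P R M"
  proof (rule submoduleI[OF _ _ _ _ smult])
    have "\<zero>\<^bsub>loc_module R S M\<^esub> \<in> Q"
      using subgroup.one_closed[OF submodule.axioms(1)[OF sQ]] by simp
    then show "\<zero>\<^bsub>M\<^esub> \<in> ?P"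
      by (simp add: zero_loc)
  next
    fix m assume m: "m \<in> ?P"
    then have "\<ominus>\<^bsub>M\<^esub> m = (\<ominus> \<one>) \<odot>\<^bsub>M\<^esub> m"
      using smult_l_minus[of \<one> m] by simp
    then show "\<ominus>\<^bsub>M\<^esub> m \<in> ?P"
      using smult[of "\<ominus> \<one>" m] m by simp
  next
    fix m n assume mn: "m \<in> ?P" "n \<in> ?P"
    then have "fr (m \<oplus>\<^bsub>M\<^esub> n) \<one> = fr m \<one> \<oplus>\<^bsub>loc_module R S M\<^esub> fr n \<one>"
      by (simp add: add_frac)
    then show "m \<oplus>\<^bsub>M\<^esub> n \<in> ?P"
      using mn QE(5) by auto
  qed auto
  moreover have "?P \<noteq> carrier M"
  proof
    assume eq: "?P = carrier M"
    have "fr m s \<in> Q" if "m \<in> carrier M" "s \<in> S" for m s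
      using that eq by (intro frac_mem_change_denom[OF sQ, of m \<one> s]) auto
    then have "carrier (loc_module R S M) \<subseteq> Q"
      by (auto simp: carrier_loc)
    with neq QE(1) show False
      by auto
  qed
  moreover have "m \<in> ?P \<or> a \<in> submodule_colon ?P R M"
    if a: "a \<in> carrier R" and m: "m \<in> carrier M" and am: "a \<odot>\<^bsub>M\<^esub> m \<in> ?P" for a m
  proof -
    have "reg.fr a \<one> \<odot>\<^bsub>loc_module R S M\<^esub> fr m \<one> \<in> Q"
      using a m am by (simp add: scalar)
    then have "fr m \<one> \<in> Q \<or> reg.fr a \<one> \<in> submodule_colon Q (loc_ring R S) (loc_module R S M)"
      using Q a m by (simp add: prime_submodule_def)
    then show ?thesis
      using a m by (auto simp: submodule_colon_def scalar)
  qed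
  ultimately show ?thesis
    by (auto simp: prime_submodule_def)
qed

lemma frac_mem_rad_loc_submodule:
  assumes m: "m \<in> carrier M" "u \<in> S" "s \<in> S"
    and rad: "u \<odot>\<^bsub>M\<^esub> m \<in> submodule_rad N R M" and N: "N \<subseteq> carrier M"
  shows "fr m s \<in> submodule_rad (loc_submodule R S M N) (loc_ring R S) (loc_module R S M)"
proof -
  have "fr m s \<in> Q"
    if Q: "prime_submodule Q (loc_ring R S) (loc_module R S M)"
      and sub: "loc_submodule R S M N \<subseteq> Q" for Q
  proof -
    have "N \<subseteq> {m \<in> carrier M. fr m \<one> \<in> Q}"
      using N sub frac_mem_loc_submodule by auto
    then have "fr (u \<odot>\<^bsub>M\<^esub> m) \<one> \<in> Q"
      using rad prime_submodule_contract[OF Q] by (auto simp: submodule_rad_iff)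
    then show ?thesis
      using Q m by (intro frac_mem_if_smult_frac_mem[of Q m u \<one> s]) (auto simp: prime_submodule_def)
  qed
  then show ?thesis
    using m by (auto simp: L.submodule_rad_iff)
qed

lemma frac_mem_colon_loc_submodule:
  assumes "a \<in> submodule_colon N R M" "s \<in> S"
  shows "reg.fr a s \<in> submodule_colon (loc_submodule R S M N) (loc_ring R S) (loc_module R S M)"
  using assms
  by (auto simp: submodule_colon_def smult_frac intro!: frac_mem_loc_submodule elim!: loc_cases)

end

section \<open>Localization of 1-absorbing primary submodules\<close>

theorem proposition5:
  fixes R :: "('a, 'r) ring_scheme" and M :: "('a, 'b, 'm) module_scheme"
    and S :: "'a set" and N :: "'b set"
  assumes "module R M"
    and "\<one>\<^bsub>R\<^esub> \<noteq> \<zero>\<^bsub>R\<^esub>"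
    and "submonoid S R"
    and "one_absorbing_primary_submodule N R M"
    and "loc_submodule R S M N \<noteq> carrier (loc_module R S M)"
  shows "one_absorbing_primary_submodule
    (loc_submodule R S M N) (loc_ring R S) (loc_module R S M)"
proof -
  interpret module_localization R M S
    using assms(1,3) by (rule module_localization.intro)
  have N: "submodule N R M"
    using assms(4) by (simp add: one_absorbing_primary_submodule_def)
  have "A \<otimes>\<^bsub>loc_ring R S\<^esub> B \<in> submodule_colon (loc_submodule R S M N) (loc_ring R S) (loc_module R S M)
      \<or> x \<in> submodule_rad (loc_submodule R S M N) (loc_ring R S) (loc_module R S M)"
    if A: "A \<in> carrier (loc_ring R S)" "A \<notin> Units (loc_ring R S)"
      and B: "B \<in> carrier (loc_ring R S)" "B \<notin> Units (loc_ring R S)"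
      and x: "x \<in> carrier (loc_module R S M)"
      and mem: "(A \<otimes>\<^bsub>loc_ring R S\<^esub> B) \<odot>\<^bsub>loc_module R S M\<^esub> x \<in> loc_submodule R S M N"
    for A B x
  proof -
    obtain a s b t m r where a: "a \<in> carrier R" "s \<in> S" "A = reg.fr a s"
      and b: "b \<in> carrier R" "t \<in> S" "B = reg.fr b t"
      and m: "m \<in> carrier M" "r \<in> S" "x = fr m r"
      using A(1) B(1) x by (elim loc_ring_cases loc_cases)
    have "fr ((a \<otimes>\<^bsub>R\<^esub> b) \<odot>\<^bsub>M\<^esub> m) (s \<otimes>\<^bsub>R\<^esub> t \<otimes>\<^bsub>R\<^esub> r) \<in> loc_submodule R S M N"
      using mem a b m by (simp add: mult_frac smult_frac)
    then obtain u where u: "u \<in> S" "u \<odot>\<^bsub>M\<^esub> ((a \<otimes>\<^bsub>R\<^esub> b) \<odot>\<^bsub>M\<^esub> m) \<in> N"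
      using frac_mem_loc_submodule_iff[OF N, of "(a \<otimes>\<^bsub>R\<^esub> b) \<odot>\<^bsub>M\<^esub> m" "s \<otimes>\<^bsub>R\<^esub> t \<otimes>\<^bsub>R\<^esub> r"] a b m
      by auto
    then have "(a \<otimes>\<^bsub>R\<^esub> b) \<odot>\<^bsub>M\<^esub> (u \<odot>\<^bsub>M\<^esub> m) \<in> N"
      using smult_left_commute[of u "a \<otimes>\<^bsub>R\<^esub> b" m] a b m by simp
    moreover have "a \<notin> Units R" "b \<notin> Units R"
      using frac_Units A(2) B(2) a b by auto
    ultimately consider "a \<otimes>\<^bsub>R\<^esub> b \<in> submodule_colon N R M" | "u \<odot>\<^bsub>M\<^esub> m \<in> submodule_rad N R M"
      using assms(4) a(1) b(1) m(1) u(1) unfolding one_absorbing_primary_submodule_def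
      by (meson Diff_iff S.mem_carrier smult_closed)
    then show ?thesis
    proof cases
      case 1
      then show ?thesis
        using frac_mem_colon_loc_submodule[of "a \<otimes>\<^bsub>R\<^esub> b" N "s \<otimes>\<^bsub>R\<^esub> t"] a b by (simp add: mult_frac)
    next
      case 2
      then show ?thesis
        using frac_mem_rad_loc_submodule[OF m(1) u(1) m(2)] submoduleE(1)[OF N] m(3) by simp
    qed
  qed
  then show ?thesis
    using loc_submodule_submodule[OF N] assms(5)
    by (auto simp: one_absorbing_primary_submodule_def)
qed

end
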